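(* Let $h,y\in\mathbb{R}$ and let $L^{(h,y)}$ be the generalized binomial operator on $\mathcal{S}(\mathbb{R})$. Then: (1) If $h\neq 1$, $h\neq -1$ and $y\neq 0$, the only sequence in $\mathcal{S}(\mathbb{R})$ fixed by $L^{(h,y)}$ is $\left(\left(\frac{y}{1-h}\right)^n\right)_{n\ge 0}$. (2) If $h=1$, then $L^{(1,y)}$ has fixed sequences in $\mathcal{S}(\mathbb{R})$ if and only if $y=0$ (in which case $L^{(1,0)}$ is the identity operator). (3) If $y=0$, $h\neq 1$ and $h\neq -1$, the only sequence in $\mathcal{S}(\mathbb{R})$ fixed by $L^{(h,0)}$ is $(1,0,0,0,\dots)$, i.e. $a_0=1$ and $a_n=0$ for all $n\ge1$. (4) If $y=0$ and $h=-1$, a sequence $a\in\mathcal{S}(\mathbb{R})$ is fixed by $L^{(-1,0)}$ exactly when its exponential generating function $\mathcal{A}(t)=\sum_{n\ge0}a_n t^n/n!$ is an even function (with $\mathcal{A}(0)=1$). (5) If $y\neq 0$ and $h=-1$, then the exponential generating function $\mathcal{A}(t)$ of any sequence fixed by $L^{(-1,y)}$ satisfies $\mathcal{A}(t)=\phi(e^{yt})$, where $\phi(u)=\mathcal{A}(\log(u)/y)$ satisfies the functional equation $\phi(u)=u\,\phi(1/u)$ for all $u>0$, together with $\phi(1)=1$.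
   Context: $\mathcal{S}(\mathbb{R})$ denotes the set of sequences $a=(a_n)_{n\ge0}$ of real numbers with $a_0=1$. For $h,y\in\mathbb{R}$, the generalized binomial operator $L^{(h,y)}$ maps $a\in\mathcal{S}(\mathbb{R})$ to the sequence $b$ with $b_n=\sum_{i=0}^n\binom{n}{i}h^i y^{n-i}a_i$, with the convention $0^0=1$ (so $L^{(0,y)}(a)=(y^n a_0)_n$, $L^{(h,0)}(a)=(h^na_n)_n$, $L^{(0,0)}(a)=(a_0,0,0,\dots)$). Equivalently, if $\mathcal{A}(t)=\sum_n a_n t^n/n!$ is the exponential generating function of $a$, then $b$ has exponential generating function $e^{yt}\mathcal{A}(ht)$; a sequence $a$ is fixed iff $\mathcal{A}(t)=e^{yt}\mathcal{A}(ht)$. Exponential generating functions are regarded as functions of the real variable $t$.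
   Formalization: In (4), evenness is stated for the formal series for all sequences and for the real function only when the series has positive radius of convergence (otherwise a_n=(n!)^2 is a counterexample); in (5), φ(u)=uφ(1/u) is stated for those u>0 at which the series defining φ(u) converges. *)

theory Defs
  imports "HOL-Analysis.Analysis"
begin

definition unit_seqs :: "(nat \<Rightarrow> real) set" where
  "unit_seqs = {a. a 0 = 1}"

text \<open>The convention \<open>0 ^ 0 = 1\<close> is the one built into the power operation.\<close>

definition gen_binomial :: "real \<Rightarrow> real \<Rightarrow> (nat \<Rightarrow> real) \<Rightarrow> (nat \<Rightarrow> real)" where
  "gen_binomial h y a = (\<lambda>n. \<Sum>i=0..n. real (n choose i) * h ^ i * y ^ (n - i) * a i)"

lemma gen_binomial_unit_seqs: "a \<in> unit_seqs \<Longrightarrow> gen_binomial h y a \<in> unit_seqs"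
  by (simp add: unit_seqs_def gen_binomial_def)

definition fixed_seqs :: "real \<Rightarrow> real \<Rightarrow> (nat \<Rightarrow> real) set" where
  "fixed_seqs h y = {a \<in> unit_seqs. gen_binomial h y a = a}"

definition egf_fps :: "(nat \<Rightarrow> real) \<Rightarrow> real fps" where
  "egf_fps a = Abs_fps (\<lambda>n. a n / fact n)"

text \<open>
  As a function of a real variable, the exponential generating function is partial: its
  domain is the set of points where the series converges, and \<open>egf a t\<close> is meaningful
  only for \<open>t \<in> egf_dom a\<close>.
\<close>

definition egf_dom :: "(nat \<Rightarrow> real) \<Rightarrow> real set" where
  "egf_dom a = {t. summable (\<lambda>n. a n * t ^ n / fact n)}"

definition egf :: "(nat \<Rightarrow> real) \<Rightarrow> real \<Rightarrow> real" where
  "egf a t = (\<Sum>n. a n * t ^ n / fact n)"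

definition even_function_on :: "real set \<Rightarrow> (real \<Rightarrow> real) \<Rightarrow> bool" where
  "even_function_on D f \<longleftrightarrow> (\<forall>t\<in>D. - t \<in> D \<and> f (- t) = f t)"

text \<open>The formal counterpart of evenness: \<open>F(- X) = F(X)\<close>.\<close>

definition even_fps :: "real fps \<Rightarrow> bool" where
  "even_fps F \<longleftrightarrow> fps_compose F (- fps_X) = F"

end

theory Submission
  imports Defs "HOL-Complex_Analysis.Cauchy_Integral_Formula"
begin

text \<open>
  At index \<open>n\<close> the fixed point equation reads \<open>(1 - h ^ n) * a n = \<dots>\<close>, where the right-hand side
  involves only earlier terms; so for \<open>h \<noteq> 1\<close> and \<open>h \<noteq> -1\<close> there is at most one fixed sequence, and
  the binomial theorem shows that the powers of \<open>y / (1 - h)\<close> form one. For \<open>h = -1\<close> the equation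
  says that the power series at \<open>-t\<close> is the Cauchy product of the series at \<open>t\<close> with that of
  \<open>exp (- y * t)\<close>. The latter converges absolutely, so by Mertens' theorem convergence at \<open>t\<close>
  gives convergence at \<open>-t\<close>, even at the end points of the interval of convergence.
\<close>

section \<open>Two facts on power series: products and vanishing coefficients\<close>

text \<open>Collect the \<open>n\<close>-th partial sum of the product by the index \<open>j\<close>
  of \<open>b\<close>: the factor of \<open>b j\<close> is the partial sum of \<open>a\<close> of
  length \<open>n - j\<close>, which is bounded by \<open>M\<close> and tends to \<open>A\<close>.
  Tannery's theorem with majorant \<open>M * norm (b j)\<close> then allows the limit in
  \<open>n\<close> to be taken term by term.\<close>

lemma Cauchy_product_sums_Mertens:
  fixes a b :: "nat \<Rightarrow> 'a::{real_normed_algebra,banach}"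
  assumes a: "a sums A" and b: "summable (\<lambda>k. norm (b k))"
  shows "(\<lambda>k. \<Sum>i\<le>k. a i * b (k - i)) sums (A * suminf b)"
proof -
  define f where "f = (\<lambda>j n. if j < n then (\<Sum>i<n - j. a i) * b j else 0)"
  have partial: "(\<lambda>n. \<Sum>i<n. a i) \<longlonglongrightarrow> A"
    using a by (simp add: sums_def)
  then obtain M where M: "\<And>n. norm (\<Sum>i<n. a i) \<le> M"
    by (metis BseqE convergentI convergent_imp_Bseq)
  have bound: "norm (f j n) \<le> M * norm (b j)" for j n
  proof -
    have "norm ((\<Sum>i<n - j. a i) * b j) \<le> M * norm (b j)"
      by (meson M mult_right_mono norm_ge_zero norm_mult_ineq order_trans)
    \<comment> \<open>This covers the default value 0 of \<open>f j n\<close> for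
      \<open>n \<le> j\<close>.\<close>
    moreover have "0 \<le> M * norm (b j)"
      by (meson M norm_ge_zero order_trans zero_le_mult_iff)
    ultimately show ?thesis
      by (simp add: f_def)
  qed
  have limit: "f j \<longlonglongrightarrow> A * b j" for j
  proof -
    have "(\<lambda>n. (\<Sum>i<n - j. a i) * b j) \<longlonglongrightarrow> A * b j"
      by (intro tendsto_intros filterlim_compose[OF partial] filterlim_minus_const_nat_at_top)
    moreover have "\<forall>\<^sub>F n in sequentially. (\<Sum>i<n - j. a i) * b j = f j n"
      using eventually_gt_at_top[of j] by eventually_elim (simp add: f_def)
    ultimately show ?thesis
      by (rule Lim_transform_eventually)
  qed
  have "(\<lambda>n. \<Sum>j. f j n) \<longlonglongrightarrow> (\<Sum>j. A * b j)"
  proof (intro conjunct2[OF conjunct2[OF tannerys_theorem]])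
    show "\<forall>\<^sub>F (j, n) in sequentially \<times>\<^sub>F sequentially. norm (f j n) \<le> M * norm (b j)"
      using bound by (intro always_eventually) auto
  qed (use limit b in \<open>auto intro: summable_mult\<close>)
  moreover have "(\<Sum>j. f j n) = (\<Sum>k<n. \<Sum>i\<le>k. a i * b (k - i))" for n
  proof -
    have "(\<Sum>j. f j n) = (\<Sum>j<n. f j n)"
      by (rule suminf_finite) (auto simp: f_def)
    also have "\<dots> = (\<Sum>j<n. \<Sum>i<n - j. a i * b j)"
      by (simp add: f_def sum_distrib_right)
    also have "\<dots> = (\<Sum>(j,i)\<in>Sigma {..<n} (\<lambda>j. {..<n - j}). a i * b j)"
      by (rule sum.Sigma) auto
    also have "\<dots> = (\<Sum>(i,j)\<in>{(i,j). i + j < n}. a i * b j)"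
      by (rule sum.reindex_bij_witness[where i = prod.swap and j = prod.swap]) auto
    also have "\<dots> = (\<Sum>k<n. \<Sum>i\<le>k. a i * b (k - i))"
      by (rule sum.triangle_reindex)
    finally show ?thesis .
  qed
  ultimately show ?thesis
    using summable_norm_cancel[OF b] by (simp add: sums_def suminf_mult)
qed

text \<open>A nonzero coefficient of positive index would make 0 an isolated zero of the sum. The
  constant coefficient is the value at 0.\<close>

lemma powser_zero_imp_coeffs_zero:
  fixes a :: "nat \<Rightarrow> 'a::{real_normed_field,banach}"
  assumes "0 < r" and "\<And>x. norm x < r \<Longrightarrow> (\<lambda>n. a n * x ^ n) sums 0"
  shows "a n = 0"
proof (cases "n = 0")
  case True
  with assms(1) assms(2)[of 0] show ?thesis
    by (simp add: powser_sums_zero_iff)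
next
  case False
  show ?thesis
  proof (rule ccontr)
    assume "a n \<noteq> 0"
    \<comment> \<open>The sum is constantly 0, so the odd-looking \<open>0 \<noteq> 0\<close> says
      that the punctured ball is empty; \<open>of_real s\<close> lies in it.\<close>
    then obtain s where s: "0 < s"
      "\<And>z::'a. z \<in> cball 0 s - {0} \<Longrightarrow> (0::'a) \<noteq> 0"
      using False assms
      by (elim powser_0_nonzero[where \<xi> = 0 and f = "\<lambda>_. 0", rotated 3]) auto
    have "(of_real s :: 'a) \<in> cball 0 s - {0}"
      using s(1) by simp
    with s(2) show False
      by blast
  qed
qed

section \<open>Uniqueness and existence of fixed sequences\<close>

lemma fixed_seqs_eqI:
  assumes h: "\<And>n. 0 < n \<Longrightarrow> h ^ n \<noteq> 1"
    and a: "a \<in> fixed_seqs h y" and b: "b \<in> fixed_seqs h y"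
  shows "a = b"
proof
  fix n
  show "a n = b n"
  proof (induction n rule: less_induct)
    case (less n)
    show ?case
    proof (cases "n = 0")
      \<comment> \<open>At index 0 the fixed point equation is void, since \<open>h ^ 0 = 1\<close>;
        the normalisation \<open>a 0 = 1\<close> takes its place.\<close>
      case True
      with a b show ?thesis
        by (simp add: fixed_seqs_def unit_seqs_def)
    next
      case False
      have expand: "c n = (\<Sum>i<n. real (n choose i) * h ^ i * y ^ (n - i) * c i) + h ^ n * c n"
        if "c \<in> fixed_seqs h y" for c
      proof -
        have "c n = gen_binomial h y c n"
          using that by (simp add: fixed_seqs_def)
        then show ?thesis
          by (simp add: gen_binomial_def atLeast0AtMost flip: lessThan_Suc_atMost)
      qed
      have "(\<Sum>i<n. real (n choose i) * h ^ i * y ^ (n - i) * a i) =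
            (\<Sum>i<n. real (n choose i) * h ^ i * y ^ (n - i) * b i)"
        using less by (intro sum.cong) auto
      with expand[OF a] expand[OF b] have "(1 - h ^ n) * a n = (1 - h ^ n) * b n"
        by (simp add: algebra_simps)
      with h False show ?thesis
        by simp
    qed
  qed
qed

text \<open>The operator sends the powers of \<open>c\<close> to the powers of
  \<open>h * c + y\<close>, and \<open>y / (1 - h)\<close> is the fixed point of this affine
  map.\<close>

lemma geometric_fixed:
  fixes h y :: real
  assumes "h \<noteq> 1"
  shows "(\<lambda>n. (y / (1 - h)) ^ n) \<in> fixed_seqs h y"
proof -
  define c where "c = y / (1 - h)"
  have c: "h * c + y = c"
    using assms by (simp add: c_def field_simps)
  have "gen_binomial h y (\<lambda>n. c ^ n) n = (h * c + y) ^ n" for n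
    by (simp add: gen_binomial_def binomial_ring atLeast0AtMost power_mult_distrib mult_ac)
  with c show ?thesis
    by (simp add: fixed_seqs_def unit_seqs_def fun_eq_iff flip: c_def)
qed

text \<open>The case \<open>y = 0\<close> is included: the powers of 0 are the sequence 1, 0, 0, and
  so on, so two cases of the theorem follow from here.\<close>

lemma fixed_seqs_unique:
  fixes h y :: real
  assumes "h \<noteq> 1" "h \<noteq> -1"
  shows "fixed_seqs h y = {\<lambda>n. (y / (1 - h)) ^ n}"
proof -
  \<comment> \<open>The only real roots of unity are 1 and -1.\<close>
  have "h ^ n \<noteq> 1" if "0 < n" for n
    using assms that by (auto simp: power_eq_1_iff dest!: power_eq_1_iff[rotated])
  then show ?thesis
    using geometric_fixed[OF assms(1), of y] fixed_seqs_eqI by blast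
qed

lemma gen_binomial_0: "gen_binomial h 0 a n = h ^ n * a n"
proof -
  have "gen_binomial h 0 a n = (\<Sum>i=0..n. if i = n then h ^ n * a n else 0)"
    unfolding gen_binomial_def by (rule sum.cong) (auto simp: power_0_left)
  then show ?thesis
    by simp
qed

text \<open>With \<open>a 0 = 1\<close>, the equation at index 1 reads
  \<open>y + a 1 = a 1\<close>.\<close>

lemma fixed_seqs_one_imp:
  assumes "a \<in> fixed_seqs 1 y"
  shows "y = 0"
proof -
  have "gen_binomial 1 y a 1 = a 1" and "a 0 = 1"
    using assms by (auto simp: fixed_seqs_def unit_seqs_def)
  then show ?thesis
    by (simp add: gen_binomial_def)
qed

section \<open>Evenness as a condition on coefficients\<close>

text \<open>The condition on the right is the common criterion to which formal evenness and evenness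
  of the function are also reduced.\<close>

lemma fixed_seqs_minus_one_iff:
  assumes "a \<in> unit_seqs"
  shows "a \<in> fixed_seqs (-1) 0 \<longleftrightarrow> (\<forall>n. (-1) ^ n * a n = a n)"
  using assms by (simp add: fixed_seqs_def gen_binomial_0 fun_eq_iff)

lemma even_fps_egf_iff: "even_fps (egf_fps a) \<longleftrightarrow> (\<forall>n. (-1) ^ n * a n = a n)"
  by (simp add: even_fps_def egf_fps_def fps_compose_uminus' fps_eq_iff)

text \<open>The positive radius serves the forward direction: with radius 0 the domain is
  \<open>{0}\<close>, where evenness says nothing about the coefficients.\<close>

lemma even_egf_iff:
  assumes "fps_conv_radius (egf_fps a) > 0"
  shows "even_function_on (egf_dom a) (egf a) \<longleftrightarrow> (\<forall>n. (-1) ^ n * a n = a n)"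
proof
  assume *: "\<forall>n. (-1) ^ n * a n = a n"
  have "a n * (- t) ^ n = a n * t ^ n" for n t
    using *[rule_format, of n] by (metis mult.assoc mult.commute power_minus)
  then show "even_function_on (egf_dom a) (egf a)"
    by (simp only: even_function_on_def egf_dom_def egf_def mem_Collect_eq) blast
next
  assume even: "even_function_on (egf_dom a) (egf a)"
  obtain r where r: "0 < r" "ereal r < fps_conv_radius (egf_fps a)"
    using ereal_dense2[OF assms] by auto
  \<comment> \<open>These are the coefficients of \<open>egf a x - egf a (- x)\<close>, which
    vanishes for \<open>norm x < r\<close>.\<close>
  have "(a n - (-1) ^ n * a n) / fact n = 0" for n
  proof (rule powser_zero_imp_coeffs_zero[OF r(1)])
    fix x :: real
    assume x: "norm x < r"
    then have "ereal (norm x) < fps_conv_radius (egf_fps a)"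
      using r(2) by (meson ereal_less(3) less_ereal.simps(1) less_trans)
    from summable_fps[OF this] have dom: "x \<in> egf_dom a"
      by (simp add: egf_dom_def egf_fps_def)
    with even have dom': "- x \<in> egf_dom a" and eq: "egf a (- x) = egf a x"
      by (auto simp: even_function_on_def)
    have "(\<lambda>n. a n * x ^ n / fact n) sums egf a x"
      "(\<lambda>n. a n * (- x) ^ n / fact n) sums egf a (- x)"
      using dom dom' by (simp_all add: egf_dom_def egf_def summable_sums)
    from sums_diff[OF this] show "(\<lambda>n. (a n - (-1) ^ n * a n) / fact n * x ^ n) sums 0"
      by (simp add: eq power_minus[of x] field_simps)
  qed
  then show "\<forall>n. (-1) ^ n * a n = a n"
    by simp
qed

section \<open>Reflection of the generating function for \<open>h = -1\<close>\<close>

lemma egf_0: "egf a 0 = a 0"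
  using powser_zero[of "\<lambda>n. a n / fact n"] by (simp add: egf_def)

text \<open>The form with \<open>sums\<close> yields both convergence at \<open>- t\<close> and the
  value there.\<close>

lemma egf_reflection_sums:
  assumes a: "a \<in> fixed_seqs (-1) y" and t: "t \<in> egf_dom a"
  shows "(\<lambda>n. a n * (- t) ^ n / fact n) sums (egf a t * exp (- (y * t)))"
proof -
  define e where "e = (\<lambda>n. (- (y * t)) ^ n / fact n)"
  \<comment> \<open>Since \<open>t ^ i * (- (y * t)) ^ (n - i)\<close> equals
    \<open>(-1) ^ i * y ^ (n - i) * (- t) ^ n\<close>, the operator appears with a common factor
    \<open>(- t) ^ n / fact n\<close>, and \<open>a\<close> is fixed by it.\<close>
  have conv: "(\<Sum>i\<le>n. a i * t ^ i / fact i * e (n - i)) = a n * (- t) ^ n / fact n" for n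
  proof -
    have "a i * t ^ i / fact i * e (n - i) =
        real (n choose i) * (-1) ^ i * y ^ (n - i) * a i * ((- t) ^ n / fact n)" if "i \<le> n" for i
    proof -
      have "(- t) ^ n = (- t) ^ i * (- t) ^ (n - i)"
        using that by (simp flip: power_add)
      moreover have "t ^ i = (-1) ^ i * (- t) ^ i"
        by (simp flip: power_mult_distrib)
      moreover have "(- (y * t)) ^ (n - i) = y ^ (n - i) * (- t) ^ (n - i)"
        by (simp flip: power_mult_distrib)
      ultimately show ?thesis
        using that by (simp add: e_def binomial_fact)
    qed
    then have "(\<Sum>i\<le>n. a i * t ^ i / fact i * e (n - i)) =
        gen_binomial (-1) y a n * ((- t) ^ n / fact n)"
      unfolding gen_binomial_def atLeast0AtMost sum_distrib_right
      by (intro sum.cong) auto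
    then show ?thesis
      using a by (simp add: fixed_seqs_def)
  qed
  have "(\<lambda>n. a n * t ^ n / fact n) sums egf a t"
    using t by (simp add: egf_dom_def egf_def summable_sums)
  moreover have "summable (\<lambda>n. norm (e n))"
    using summable_norm_exp[of "- (y * t)"] by (simp add: e_def divide_inverse mult.commute)
  ultimately have "(\<lambda>n. \<Sum>i\<le>n. a i * t ^ i / fact i * e (n - i)) sums (egf a t * suminf e)"
    by (rule Cauchy_product_sums_Mertens)
  moreover have "suminf e = exp (- (y * t))"
    by (simp add: e_def exp_def divide_inverse mult.commute)
  ultimately show ?thesis
    by (simp only: conv)
qed

lemma egf_reflection:
  assumes "a \<in> fixed_seqs (-1) y" and "t \<in> egf_dom a"
  shows "- t \<in> egf_dom a" and "egf a (- t) = exp (- (y * t)) * egf a t"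
  using egf_reflection_sums[OF assms] by (simp_all add: egf_dom_def egf_def sums_iff)

text \<open>Under the substitution \<open>u = exp (y * t)\<close>, passing from \<open>u\<close> to
  \<open>1 / u\<close> is the reflection of \<open>t\<close>, and the factor
  \<open>exp (- (y * t))\<close> becomes \<open>1 / u\<close>. Nothing is assumed of \<phi> at
  arguments that are not positive.\<close>

lemma fixed_seqs_minus_one_functional_equation:
  fixes \<phi> :: "real \<Rightarrow> real"
  assumes y: "y \<noteq> 0" and a: "a \<in> fixed_seqs (-1) y"
    and \<phi>: "\<And>u. 0 < u \<Longrightarrow> \<phi> u = egf a (ln u / y)"
  shows "egf a t = \<phi> (exp (y * t))"
    and "0 < u \<Longrightarrow> ln u / y \<in> egf_dom a \<Longrightarrow> ln (1 / u) / y \<in> egf_dom a"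
    and "0 < u \<Longrightarrow> ln u / y \<in> egf_dom a \<Longrightarrow> \<phi> u = u * \<phi> (1 / u)"
    and "\<phi> 1 = 1"
proof -
  show "egf a t = \<phi> (exp (y * t))"
    using y by (simp add: \<phi>)
  show "\<phi> 1 = 1"
    using a by (simp add: \<phi> egf_0 fixed_seqs_def unit_seqs_def)
  assume u: "0 < u" and dom: "ln u / y \<in> egf_dom a"
  have neg: "ln (1 / u) / y = - (ln u / y)"
    using u by (simp add: ln_div)
  show "ln (1 / u) / y \<in> egf_dom a"
    using egf_reflection(1)[OF a dom] by (simp only: neg)
  have "\<phi> (1 / u) = exp (- (y * (ln u / y))) * egf a (ln u / y)"
    using u egf_reflection(2)[OF a dom] \<phi>[of "1 / u"] by (simp only: neg) simp
  also have "\<dots> = \<phi> u / u"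
    using u y by (simp add: \<phi> exp_minus field_simps)
  finally show "\<phi> u = u * \<phi> (1 / u)"
    using u by simp
qed

section \<open>The classification by \<open>h\<close> and \<open>y\<close>\<close>

theorem theorem5:
  fixes h y :: real
  shows
    "(h \<noteq> 1 \<and> h \<noteq> -1 \<and> y \<noteq> 0 \<longrightarrow>
        fixed_seqs h y = {\<lambda>n. (y / (1 - h)) ^ n}) \<and>
     (h = 1 \<longrightarrow>
        (fixed_seqs h y \<noteq> {} \<longleftrightarrow> y = 0) \<and>
        (y = 0 \<longrightarrow> (\<forall>a\<in>unit_seqs. gen_binomial h y a = a))) \<and>
     (y = 0 \<and> h \<noteq> 1 \<and> h \<noteq> -1 \<longrightarrow>
        fixed_seqs h y = {\<lambda>n. if n = 0 then 1 else 0}) \<and>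
     (y = 0 \<and> h = -1 \<longrightarrow>
        (\<forall>a\<in>unit_seqs.
           (a \<in> fixed_seqs h y \<longleftrightarrow>
              even_fps (egf_fps a) \<and> fps_nth (egf_fps a) 0 = 1) \<and>
           (fps_conv_radius (egf_fps a) > 0 \<longrightarrow>
              (a \<in> fixed_seqs h y \<longleftrightarrow>
                 even_function_on (egf_dom a) (egf a) \<and> egf a 0 = 1)))) \<and>
     (y \<noteq> 0 \<and> h = -1 \<longrightarrow>
        (\<forall>a\<in>fixed_seqs h y.
           \<forall>\<phi> :: real \<Rightarrow> real. (\<forall>u>0. \<phi> u = egf a (ln u / y)) \<longrightarrow>
             (\<forall>t\<in>egf_dom a. egf a t = \<phi> (exp (y * t))) \<and>
             (\<forall>u>0. ln u / y \<in> egf_dom a \<longrightarrow>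
                ln (1 / u) / y \<in> egf_dom a \<and> \<phi> u = u * \<phi> (1 / u)) \<and>
             \<phi> 1 = 1))"
proof (intro conjI impI)
  assume "h \<noteq> 1 \<and> h \<noteq> -1 \<and> y \<noteq> 0"
  then show "fixed_seqs h y = {\<lambda>n. (y / (1 - h)) ^ n}"
    by (simp add: fixed_seqs_unique)
next
  assume h: "h = 1"
  show "fixed_seqs h y \<noteq> {} \<longleftrightarrow> y = 0"
  proof
    assume "fixed_seqs h y \<noteq> {}"
    with h show "y = 0"
      using fixed_seqs_one_imp by blast
  next
    assume "y = 0"
    \<comment> \<open>Any sequence with first term 1 would serve, as the operator is the
      identity.\<close>
    with h have "(\<lambda>_. 1) \<in> fixed_seqs h y"
      by (simp add: fixed_seqs_def unit_seqs_def gen_binomial_0 fun_eq_iff)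
    then show "fixed_seqs h y \<noteq> {}"
      by blast
  qed
  assume "y = 0"
  with h show "\<forall>a\<in>unit_seqs. gen_binomial h y a = a"
    by (simp add: gen_binomial_0 fun_eq_iff)
next
  assume "y = 0 \<and> h \<noteq> 1 \<and> h \<noteq> -1"
  then show "fixed_seqs h y = {\<lambda>n. if n = 0 then 1 else 0}"
    by (simp add: fixed_seqs_unique power_0_left)
next
  assume *: "y = 0 \<and> h = -1"
  show "\<forall>a\<in>unit_seqs.
           (a \<in> fixed_seqs h y \<longleftrightarrow>
              even_fps (egf_fps a) \<and> fps_nth (egf_fps a) 0 = 1) \<and>
           (fps_conv_radius (egf_fps a) > 0 \<longrightarrow>
              (a \<in> fixed_seqs h y \<longleftrightarrow>
                 even_function_on (egf_dom a) (egf a) \<and> egf a 0 = 1))"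
  proof
    fix a
    assume a: "a \<in> unit_seqs"
    \<comment> \<open>The normalisation makes the second conjunct of both characterisations
      automatic, which leaves the criterion on coefficients.\<close>
    then have "fps_nth (egf_fps a) 0 = 1" "egf a 0 = 1"
      by (simp_all add: unit_seqs_def egf_fps_def egf_0)
    with a * show "(a \<in> fixed_seqs h y \<longleftrightarrow>
              even_fps (egf_fps a) \<and> fps_nth (egf_fps a) 0 = 1) \<and>
           (fps_conv_radius (egf_fps a) > 0 \<longrightarrow>
              (a \<in> fixed_seqs h y \<longleftrightarrow>
                 even_function_on (egf_dom a) (egf a) \<and> egf a 0 = 1))"
      by (simp add: fixed_seqs_minus_one_iff even_fps_egf_iff even_egf_iff)
  qed
next
  assume "y \<noteq> 0 \<and> h = -1"
  then show "\<forall>a\<in>fixed_seqs h y.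
           \<forall>\<phi> :: real \<Rightarrow> real. (\<forall>u>0. \<phi> u = egf a (ln u / y)) \<longrightarrow>
             (\<forall>t\<in>egf_dom a. egf a t = \<phi> (exp (y * t))) \<and>
             (\<forall>u>0. ln u / y \<in> egf_dom a \<longrightarrow>
                ln (1 / u) / y \<in> egf_dom a \<and> \<phi> u = u * \<phi> (1 / u)) \<and>
             \<phi> 1 = 1"
    using fixed_seqs_minus_one_functional_equation by blast
qed

end
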